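(* Let $\mathfrak{s}$ be a finite-dimensional non-nilpotent solvable complex Lie algebra with abelian nilradical $\mathfrak{n}$, $r=\dim\mathfrak{n}$, $k=\dim(\mathfrak{s}/\mathfrak{n})$, and let bases $n_1,\dots,n_r$ of $\mathfrak{n}$ and $x_1,\dots,x_k$ of a vector-space complement be chosen so that the matrices $A^\alpha$ of $\operatorname{ad}(x_\alpha)|_{\mathfrak{n}}$ are in the block form $A^\alpha=\bigoplus_{j=1}^{p+q}(a_j^\alpha I_{r_j}+N_j^\alpha)$ described in the context, with $\mathbf{a}_j\ne0$ for $1\le j\le p$ and $\mathbf{a}_j=0$ for $p<j\le p+q$. Then the characteristic polynomial of $\mathfrak{s}$ is \[ Q_{\mathfrak s}(z_0,z_1,\ldots,z_{r+k})=z_0^{e_0(\mathfrak s)}\prod_{j=1}^{p}\left(z_0+\sum_{\alpha=1}^k a_j^\alpha z_{r+\alpha}\right)^{r_j}. \] Moreover, \[ e_0(\mathfrak s)=k+\sum_{j=p+1}^{p+q}r_j,\qquad\kappa(\mathfrak s)=1+|B|, \] where $B$ is the set of distinct nonzero weights among $\mathbf a_1,\ldots,\mathbf a_p$.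
   Context: The nilradical is the unique maximal nilpotent ideal. The matrices $A^\alpha\in\mathfrak{gl}(r,\mathbb{C})$ are defined by $[x_\alpha,n_j]=\sum_{i=1}^r(A^\alpha)_{ij}n_i$; they commute, and no nontrivial linear combination of them is nilpotent. Also $[x_\alpha,x_\beta]\in\mathfrak{n}$. Block form (Ndogmo–Winternitz; every such $\mathfrak{s}$ admits bases of this kind): $A^\alpha=\bigoplus_{j=1}^{p+q}T_j^\alpha$, $T_j^\alpha=a_j^\alpha I_{r_j}+N_j^\alpha$, $\sum_{j=1}^{p+q}r_j=r$, where each $T_j^\alpha$ is triangular and, for each fixed $j$, the matrices $N_j^\alpha$ span an abelian nilpotent subalgebra of $\mathfrak{sl}(r_j,\mathbb{C})$ consisting of strictly triangular (nilpotent) matrices. Write $\mathbf{a}_j=(a_j^1,\dots,a_j^k)$. The weights satisfy $\mathbf{a}_j\ne0$ for $1\le j\le p$, $\mathbf{a}_j=0$ for $p+1\le j\le p+q$, and $a_j^\alpha=\delta_j^\alpha$ for $1\le j\le k$, with $1\le k\le p$ and $p+q\le r$. The characteristic polynomial is $Q_{\mathfrak{s}}=\det\bigl(z_0I+\sum_{i=1}^r z_i\operatorname{ad}(n_i)+\sum_{\alpha=1}^k z_{r+\alpha}\operatorname{ad}(x_\alpha)\bigr)$; $e_0(\mathfrak{s})$ is the multiplicity of the factor $z_0$ in $Q_{\mathfrak{s}}$, and $\kappa(\mathfrak{s})$ is the number of distinct irreducible factors of $Q_{\mathfrak{s}}$. *)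

theory Defs
  imports
    "HOL-Library.Poly_Mapping"
    "HOL-Computational_Algebra.Factorial_Ring"
    "Jordan_Normal_Form.Determinant"
begin

(* Complex Lie algebras, carried by a whole type; subalgebras and ideals are sets. *)

locale complex_lie_algebra = Vector_Spaces.vector_space scale
  for scale :: "complex \<Rightarrow> 'a::ab_group_add \<Rightarrow> 'a" (infixr "*s" 75) +
  fixes bracket :: "'a \<Rightarrow> 'a \<Rightarrow> 'a"
  assumes bracket_add_left: "bracket (u + v) w = bracket u w + bracket v w"
    and bracket_add_right: "bracket u (v + w) = bracket u v + bracket u w"
    and bracket_scale_left: "bracket (c *s u) v = c *s bracket u v"
    and bracket_scale_right: "bracket u (c *s v) = c *s bracket u v"
    and bracket_self: "bracket u u = 0"
    and jacobi: "bracket u (bracket v w) + bracket v (bracket w u) + bracket w (bracket u v) = 0"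
begin

definition finite_dim :: bool where
  "finite_dim \<longleftrightarrow> (\<exists>S. finite S \<and> span S = UNIV)"

definition bracket_span :: "'a set \<Rightarrow> 'a set \<Rightarrow> 'a set" where
  "bracket_span H K = span {bracket u v | u v. u \<in> H \<and> v \<in> K}"

definition is_ideal :: "'a set \<Rightarrow> bool" where
  "is_ideal I \<longleftrightarrow> subspace I \<and> (\<forall>u. \<forall>v\<in>I. bracket u v \<in> I)"

definition is_abelian :: "'a set \<Rightarrow> bool" where
  "is_abelian H \<longleftrightarrow> (\<forall>u\<in>H. \<forall>v\<in>H. bracket u v = 0)"

primrec lower_central_series :: "'a set \<Rightarrow> nat \<Rightarrow> 'a set" where
  "lower_central_series H 0 = H"
| "lower_central_series H (Suc m) = bracket_span H (lower_central_series H m)"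

primrec derived_series :: "'a set \<Rightarrow> nat \<Rightarrow> 'a set" where
  "derived_series H 0 = H"
| "derived_series H (Suc m) = bracket_span (derived_series H m) (derived_series H m)"

definition is_nilpotent :: "'a set \<Rightarrow> bool" where
  "is_nilpotent H \<longleftrightarrow> (\<exists>m. lower_central_series H m = {0})"

definition is_solvable :: "'a set \<Rightarrow> bool" where
  "is_solvable H \<longleftrightarrow> (\<exists>m. derived_series H m = {0})"

definition is_maximal_nilpotent_ideal :: "'a set \<Rightarrow> bool" where
  "is_maximal_nilpotent_ideal I \<longleftrightarrow> is_ideal I \<and> is_nilpotent I \<and>
     (\<forall>J. is_ideal J \<and> is_nilpotent J \<and> I \<subseteq> J \<longrightarrow> J = I)"

definition is_nilradical :: "'a set \<Rightarrow> bool" where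
  "is_nilradical I \<longleftrightarrow> is_maximal_nilpotent_ideal I \<and>
     (\<forall>J. is_maximal_nilpotent_ideal J \<longrightarrow> J = I)"

(* b 0, ..., b (d - 1) is an ordered basis of the subspace V *)
definition is_ordered_basis :: "nat \<Rightarrow> (nat \<Rightarrow> 'a) \<Rightarrow> 'a set \<Rightarrow> bool" where
  "is_ordered_basis d b V \<longleftrightarrow>
     inj_on b {..<d} \<and> independent (b ` {..<d}) \<and> span (b ` {..<d}) = V"

definition is_complement :: "'a set \<Rightarrow> 'a set \<Rightarrow> bool" where
  "is_complement V W \<longleftrightarrow> subspace V \<and> subspace W \<and> V \<inter> W = {0} \<and>
     {v + w | v w. v \<in> V \<and> w \<in> W} = UNIV"

(* Column j holds the coordinates of bracket u (b j). *)
definition ad_mat :: "nat \<Rightarrow> (nat \<Rightarrow> 'a) \<Rightarrow> 'a \<Rightarrow> complex mat" where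
  "ad_mat d b u = mat d d (\<lambda>(i, j). representation (b ` {..<d}) (bracket u (b j)) (b i))"

end

(* Multivariate polynomials: exponent vectors are finitely supported maps from variable
   indices to exponents. The ring has a variable for every natural number; irreducibility and
   divisors of a nonzero polynomial are the same as in the subring of the variables it uses. *)

type_synonym cmpoly = "(nat \<Rightarrow>\<^sub>0 nat) \<Rightarrow>\<^sub>0 complex"

definition Var :: "nat \<Rightarrow> cmpoly" where
  "Var i = Poly_Mapping.single (Poly_Mapping.single i 1) 1"

definition Const :: "complex \<Rightarrow> cmpoly" where
  "Const c = Poly_Mapping.single 0 c"

(* det (z_0 I + sum_l z_{l+1} ad (b l)), where the basis vectors b l are numbered from 0 *)
definition (in complex_lie_algebra) lie_char_poly :: "nat \<Rightarrow> (nat \<Rightarrow> 'a) \<Rightarrow> cmpoly" where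
  "lie_char_poly d b = det (mat d d (\<lambda>(i, j).
     (if i = j then Var 0 else 0) + (\<Sum>l<d. Var (Suc l) * Const (ad_mat d b (b l) $$ (i, j)))))"

(* The library's multiplicity needs a factorial_semiring instance, which poly_mapping lacks;
   the body is the same. *)
definition z0_multiplicity :: "cmpoly \<Rightarrow> nat" where
  "z0_multiplicity Q = (if finite {m. Var 0 ^ m dvd Q} then Max {m. Var 0 ^ m dvd Q} else 0)"

(* Irreducible factors are counted up to units, i.e. one per class of associates. *)
definition num_irreducible_factors :: "cmpoly \<Rightarrow> nat" where
  "num_irreducible_factors Q =
     card ((\<lambda>P. {P'. P dvd P' \<and> P' dvd P}) ` {P. irreducible P \<and> P dvd Q})"

definition strictly_triangular :: "complex mat \<Rightarrow> bool" where
  "strictly_triangular M \<longleftrightarrow>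
     (\<forall>i<dim_row M. \<forall>j<dim_col M. j \<le> i \<longrightarrow> M $$ (i, j) = 0) \<or>
     (\<forall>i<dim_row M. \<forall>j<dim_col M. i \<le> j \<longrightarrow> M $$ (i, j) = 0)"

definition mat_span :: "nat \<Rightarrow> nat \<Rightarrow> (nat \<Rightarrow> complex mat) \<Rightarrow> complex mat set" where
  "mat_span d k M = {mat d d (\<lambda>(i, j). \<Sum>\<alpha><k. c \<alpha> * M \<alpha> $$ (i, j)) | c. True}"

(* M 0, ..., M (k - 1) span an abelian subalgebra of sl(d) of strictly triangular matrices.
   An abelian span is closed under commutators and is a nilpotent Lie algebra. As a linear
   subspace, it is strictly upper triangular throughout or strictly lower triangular throughout. *)
definition spans_abelian_strictly_triangular :: "nat \<Rightarrow> nat \<Rightarrow> (nat \<Rightarrow> complex mat) \<Rightarrow> bool" where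
  "spans_abelian_strictly_triangular d k M \<longleftrightarrow>
     (\<forall>\<alpha><k. M \<alpha> \<in> carrier_mat d d) \<and>
     (\<forall>X\<in>mat_span d k M. (\<Sum>i<d. X $$ (i, i)) = 0 \<and> strictly_triangular X) \<and>
     (\<forall>X\<in>mat_span d k M. \<forall>Y\<in>mat_span d k M. X * Y = Y * X)"

(* All indices start at 0: basis vectors of the nilradical are i < r, complement vectors
   \<alpha> < k, blocks j < p + q (nonzero weights for j < p). The block sizes are s j, the
   weights a j, the strictly triangular parts N j \<alpha>. *)
definition block_form ::
  "nat \<Rightarrow> nat \<Rightarrow> nat \<Rightarrow> nat \<Rightarrow> (nat \<Rightarrow> nat) \<Rightarrow> (nat \<Rightarrow> complex vec) \<Rightarrow>
   (nat \<Rightarrow> nat \<Rightarrow> complex mat) \<Rightarrow> (nat \<Rightarrow> complex mat) \<Rightarrow> bool" where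
  "block_form r k p q s a N A \<longleftrightarrow>
     1 \<le> k \<and> k \<le> p \<and> p + q \<le> r \<and>
     (\<forall>j<p + q. 1 \<le> s j) \<and> (\<Sum>j<p + q. s j) = r \<and>
     (\<forall>j<p + q. a j \<in> carrier_vec k) \<and>
     (\<forall>j<p. a j \<noteq> 0\<^sub>v k) \<and>
     (\<forall>j. p \<le> j \<and> j < p + q \<longrightarrow> a j = 0\<^sub>v k) \<and>
     (\<forall>j<k. \<forall>\<alpha><k. a j $ \<alpha> = (if j = \<alpha> then 1 else 0)) \<and>
     (\<forall>j<p + q. spans_abelian_strictly_triangular (s j) k (N j)) \<and>
     (\<forall>\<alpha><k. A \<alpha> =
        diag_block_mat (map (\<lambda>j. a j $ \<alpha> \<cdot>\<^sub>m 1\<^sub>m (s j) + N j \<alpha>) [0..<p + q]))"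

end

theory Submission
  imports Defs
begin

text \<open>
  Because the nilradical \<open>\<nn>\<close> is an abelian ideal, the whole theorem rests on one structural fact,
  \<open>[x\<^sub>\<alpha>, x\<^sub>\<beta>] \<in> \<nn>\<close>. It follows from the block form: the blocks commute, so
  \<open>[x\<^sub>\<alpha>, x\<^sub>\<beta>]\<close> acts on \<open>\<nn>\<close> as the commutator of two commuting matrices, that is, as zero;
  and a combination of the \<open>x\<^sub>\<gamma>\<close> that acts as zero on \<open>\<nn>\<close> vanishes, because the weights of the first
  \<open>k\<close> blocks are the unit vectors and can be read off the diagonal
  (\<open>bracket_complement_mem_ideal\<close>, \<open>block_form_independent\<close>).

  Every bracket therefore lands in \<open>\<nn>\<close>, and in the basis \<open>n, x\<close> the matrix defining the
  characteristic polynomial is block upper triangular. Its lower right corner is \<open>z\<^sub>0 I\<^sub>k\<close>, and its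
  upper left corner is the pencil \<open>z\<^sub>0 I + \<Sum> z\<^sub>\<alpha> A\<^sup>\<alpha>\<close>, since \<open>\<nn>\<close> acts trivially on itself. The pencil
  splits along the blocks of the \<open>A\<^sup>\<alpha>\<close>. Inside one block all the nilpotent parts are triangular on
  the same side (\<open>abelian_strictly_triangular_uniform\<close>), so its determinant is the \<open>s\<^sub>j\<close>-th power of the
  linear form \<open>L(a\<^sub>j) = z\<^sub>0 + \<Sum> a\<^sub>j\<^sup>\<alpha> z\<^sub>\<alpha>\<close>, where \<open>z\<^sub>\<alpha>\<close> is the variable of \<open>x\<^sub>\<alpha>\<close>. A zero weight contributes powers of \<open>L(0) = z\<^sub>0\<close>.

  Multiplicity and number of factors then only need that the forms \<open>L(c)\<close> are prime and that
  distinct weights give non-associated forms. Both come from one divisibility test: \<open>L(c)\<close> divides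
  \<open>f\<close> exactly if \<open>f\<close> vanishes under the substitution \<open>z\<^sub>0 := - \<Sum> c\<^sup>\<alpha> z\<^sub>\<alpha>\<close>
  (\<open>dvd_iff_subst0\<close>). The target of this substitution is an integral domain, which gives primality,
  and applying it to \<open>L(d)\<close> leaves \<open>\<Sum> (d\<^sup>\<alpha> - c\<^sup>\<alpha>) z\<^sub>\<alpha>\<close>, which gives distinctness.
\<close>

section \<open>Substitution for the variable \<open>z\<^sub>0\<close>\<close>

lemma single_eq_Const_mult: "Poly_Mapping.single m c = Const c * Poly_Mapping.single m (1::complex)"
  by (simp add: Const_def mult_single)

lemma Const_0 [simp]: "Const 0 = 0" by (simp add: Const_def)
lemma Const_1 [simp]: "Const 1 = 1" by (simp add: Const_def)
lemma Const_add: "Const (c + d) = Const c + Const d" by (simp add: Const_def single_add)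
lemma Const_mult: "Const (c * d) = Const c * Const d" by (simp add: Const_def mult_single)

text \<open>
  Adding one term at a time, with no condition on whether its monomial already occurs, keeps the
  induction steps below free of side conditions.
\<close>

lemma cmpoly_induct [case_names zero add]:
  fixes f :: cmpoly
  assumes "P 0" and "\<And>m c f. P f \<Longrightarrow> P (Poly_Mapping.single m c + f)"
  shows "P f"
proof (induction f rule: update_induct)
  case const
  then show ?case by (rule assms(1))
next
  case (update f a b)
  have "Poly_Mapping.update a b f = Poly_Mapping.single a b + f"
    using update(1)
    by (intro poly_mapping_eqI) (auto simp: lookup_update lookup_add lookup_single when_def in_keys_iff)
  then show ?case using assms(2)[OF update(3)] by simp
qed

text \<open>
  The ring homomorphism fixing all variables but \<open>z\<^sub>0\<close>, which it sends to \<open>t\<close>; it is given on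
  monomials first and then extended linearly. Updating an exponent vector at \<open>0\<close> with the value \<open>0\<close>
  strips the power of \<open>z\<^sub>0\<close>.
\<close>

definition subst0_monom :: "cmpoly \<Rightarrow> (nat \<Rightarrow>\<^sub>0 nat) \<Rightarrow> cmpoly" where
  "subst0_monom t m = t ^ Poly_Mapping.lookup m 0 * Poly_Mapping.single (Poly_Mapping.update 0 0 m) 1"

definition subst0 :: "cmpoly \<Rightarrow> cmpoly \<Rightarrow> cmpoly" where
  "subst0 t f = (\<Sum>m\<in>Poly_Mapping.keys f. Const (Poly_Mapping.lookup f m) * subst0_monom t m)"

lemma subst0_monom_add: "subst0_monom t (m + m') = subst0_monom t m * subst0_monom t m'"
proof -
  have "Poly_Mapping.update 0 0 (m + m') = Poly_Mapping.update 0 0 m + Poly_Mapping.update 0 (0::nat) m'"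
    by (intro poly_mapping_eqI) (simp add: lookup_update lookup_add)
  then show ?thesis
    by (simp add: subst0_monom_def lookup_add power_add mult_single mult_ac)
qed

text \<open>
  Summing over any larger finite set of exponents lets two polynomials be compared over the union of
  their supports.
\<close>

lemma subst0_superset:
  assumes "finite S" "Poly_Mapping.keys f \<subseteq> S"
  shows "subst0 t f = (\<Sum>m\<in>S. Const (Poly_Mapping.lookup f m) * subst0_monom t m)"
  unfolding subst0_def using assms
  by (intro sum.mono_neutral_left) (auto simp: in_keys_iff)

lemma subst0_add: "subst0 t (f + g) = subst0 t f + subst0 t g"
proof -
  let ?S = "Poly_Mapping.keys f \<union> Poly_Mapping.keys g"
  have "Poly_Mapping.keys (f + g) \<subseteq> ?S" by (rule Poly_Mapping.keys_add)
  then show ?thesis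
    by (simp add: subst0_superset[of ?S] lookup_add Const_add distrib_right sum.distrib)
qed

lemma subst0_single: "subst0 t (Poly_Mapping.single m c) = Const c * subst0_monom t m"
  by (subst subst0_superset[of "{m}"]) auto

lemma subst0_zero [simp]: "subst0 t 0 = 0" by (simp add: subst0_def)

lemma subst0_mult: "subst0 t (f * g) = subst0 t f * subst0 t g"
proof (induction f rule: cmpoly_induct)
  case (add m c f)
  have "subst0 t (Poly_Mapping.single m c * g) = subst0 t (Poly_Mapping.single m c) * subst0 t g"
    by (induction g rule: cmpoly_induct)
      (simp_all add: subst0_add subst0_single mult_single subst0_monom_add Const_mult algebra_simps)
  with add show ?case by (simp add: subst0_add distrib_right)
qed simp

lemma subst0_Const [simp]: "subst0 t (Const c) = Const c"
proof -
  have "Poly_Mapping.update 0 0 0 = (0 :: nat \<Rightarrow>\<^sub>0 nat)"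
    by (intro poly_mapping_eqI) (simp add: lookup_update)
  then show ?thesis
    unfolding Const_def by (subst subst0_single) (simp add: subst0_monom_def Const_def)
qed

lemma subst0_Var: "subst0 t (Var i) = (if i = 0 then t else Var i)"
proof -
  have "Poly_Mapping.update 0 0 (Poly_Mapping.single i 1) = (if i = 0 then 0 else Poly_Mapping.single i (1::nat))"
    by (intro poly_mapping_eqI) (auto simp: lookup_update lookup_single when_def)
  then show ?thesis
    unfolding Var_def by (subst subst0_single) (auto simp: subst0_monom_def lookup_single)
qed

lemma subst0_sum: "subst0 t (sum F S) = (\<Sum>i\<in>S. subst0 t (F i))"
  by (induction S rule: infinite_finite_induct) (simp_all add: subst0_add)

lemma Var_0_power: "Var 0 ^ e = Poly_Mapping.single (Poly_Mapping.single 0 e) 1"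
  by (induction e) (simp_all add: Var_def mult_single flip: single_add)

text \<open>
  Modulo \<open>z\<^sub>0 - t\<close> the variable \<open>z\<^sub>0\<close> and \<open>t\<close> are equal, so the substitution changes nothing; on
  monomials this is the factorization of \<open>z\<^sub>0\<^sup>m - t\<^sup>m\<close>.
\<close>

lemma dvd_diff_subst0: "(Var 0 - t) dvd (f - subst0 t f)"
proof (induction f rule: cmpoly_induct)
  case (add m c f)
  have m: "m = Poly_Mapping.single 0 (Poly_Mapping.lookup m 0) + Poly_Mapping.update 0 0 m"
    by (intro poly_mapping_eqI) (auto simp: lookup_update lookup_add lookup_single when_def)
  have "Poly_Mapping.single m 1 = Var 0 ^ Poly_Mapping.lookup m 0 * Poly_Mapping.single (Poly_Mapping.update 0 0 m) 1"
    by (subst m) (simp add: Var_0_power mult_single)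
  then have "Poly_Mapping.single m c - subst0 t (Poly_Mapping.single m c) =
      (Var 0 ^ Poly_Mapping.lookup m 0 - t ^ Poly_Mapping.lookup m 0) * (Const c * Poly_Mapping.single (Poly_Mapping.update 0 0 m) 1)"
    by (subst single_eq_Const_mult) (simp add: subst0_single subst0_monom_def algebra_simps)
  moreover have "(Var 0 - t) dvd (Var 0 ^ Poly_Mapping.lookup m 0 - t ^ Poly_Mapping.lookup m 0)"
    by (metis power_diff_sumr2 dvd_triv_left)
  ultimately have "(Var 0 - t) dvd (Poly_Mapping.single m c - subst0 t (Poly_Mapping.single m c))"
    by simp
  then have "(Var 0 - t) dvd (Poly_Mapping.single m c - subst0 t (Poly_Mapping.single m c)) + (f - subst0 t f)"
    using add by (rule dvd_add)
  then show ?case by (simp add: subst0_add algebra_simps)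
qed simp

text \<open>
  The kernel of the substitution is the ideal of \<open>z\<^sub>0 - t\<close>. The hypothesis says that \<open>z\<^sub>0 - t\<close> is sent
  to \<open>0\<close>; it holds as soon as \<open>t\<close> does not contain \<open>z\<^sub>0\<close>.
\<close>

lemma dvd_iff_subst0:
  assumes "subst0 t t = t"
  shows "(Var 0 - t) dvd f \<longleftrightarrow> subst0 t f = 0"
proof
  assume "(Var 0 - t) dvd f"
  then obtain g where "f = (Var 0 - t) * g" ..
  then have "subst0 t f + subst0 t (t * g) = subst0 t (Var 0 * g)"
    by (simp add: algebra_simps flip: subst0_add)
  then show "subst0 t f = 0" by (simp add: subst0_mult subst0_Var assms)
next
  assume "subst0 t f = 0"
  then show "(Var 0 - t) dvd f" using dvd_diff_subst0[of t f] by simp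
qed

text \<open>
  The quotient by \<open>z\<^sub>0 - t\<close> embeds into the polynomial ring, which is an integral domain. Invariance
  of \<open>t\<close> under every substitution expresses that \<open>t\<close> is free of \<open>z\<^sub>0\<close>.
\<close>

lemma prime_elem_Var_minus:
  assumes "\<And>u. subst0 u t = t"
  shows "prime_elem (Var 0 - t)"
proof (rule prime_elemI)
  show "Var 0 - t \<noteq> 0"
  proof
    assume "Var 0 - t = 0"
    then have "t = Var 0" by simp
    moreover have "subst0 0 (Var 0) = 0" "subst0 1 (Var 0) = 1" by (simp_all add: subst0_Var)
    ultimately show False using assms[of 0] assms[of 1] by simp
  qed
  have "subst0 t 1 \<noteq> 0" using subst0_Const[of t 1] by simp
  then show "\<not> (Var 0 - t) dvd 1" by (simp add: dvd_iff_subst0[OF assms])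
next
  fix f g assume "(Var 0 - t) dvd f * g"
  then show "(Var 0 - t) dvd f \<or> (Var 0 - t) dvd g"
    by (simp add: dvd_iff_subst0[OF assms] subst0_mult)
qed

section \<open>The linear forms attached to the weights\<close>

text \<open>
  The variables of the weight start at index \<open>v\<close>. The form of the zero weight is \<open>z\<^sub>0\<close> itself, so
  results on all these forms cover \<open>z\<^sub>0\<close> too.
\<close>

definition linear_form :: "nat \<Rightarrow> nat \<Rightarrow> complex vec \<Rightarrow> cmpoly" where
  "linear_form k v c = Var 0 + (\<Sum>\<alpha><k. Const (c $ \<alpha>) * Var (v + \<alpha>))"

lemma subst0_linear_part:
  assumes "0 < v"
  shows "subst0 u (\<Sum>\<alpha><k. Const (c $ \<alpha>) * Var (v + \<alpha>)) = (\<Sum>\<alpha><k. Const (c $ \<alpha>) * Var (v + \<alpha>))"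
  using assms by (simp add: subst0_sum subst0_mult subst0_Var)

lemma subst0_uminus: "subst0 u (- f) = - subst0 u f"
  using subst0_add[of u f "- f"] by (simp add: eq_neg_iff_add_eq_0 add.commute)

lemma prime_elem_linear_form:
  assumes "0 < v"
  shows "prime_elem (linear_form k v c)"
  using prime_elem_Var_minus[of "- (\<Sum>\<alpha><k. Const (c $ \<alpha>) * Var (v + \<alpha>))"]
  by (simp add: linear_form_def subst0_uminus subst0_linear_part[OF assms])

lemma single_one_eq_iff: "Poly_Mapping.single i (Suc 0) = Poly_Mapping.single j (Suc 0) \<longleftrightarrow> i = j"
  by (auto dest: arg_cong[of _ _ Poly_Mapping.keys])

lemma lookup_linear_part:
  assumes "\<alpha> < k"
  shows "Poly_Mapping.lookup (\<Sum>\<beta><k. Const (c \<beta>) * Var (v + \<beta>)) (Poly_Mapping.single (v + \<alpha>) 1) = c \<alpha>"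
proof -
  have "Poly_Mapping.lookup (\<Sum>\<beta><k. Const (c \<beta>) * Var (v + \<beta>)) (Poly_Mapping.single (v + \<alpha>) 1)
      = (\<Sum>\<beta><k. if \<beta> = \<alpha> then c \<beta> else 0)"
    unfolding lookup_sum
    by (intro sum.cong refl)
       (auto simp: Const_def Var_def mult_single lookup_single when_def single_one_eq_iff)
  with assms show ?thesis by simp
qed

text \<open>
  Substituting the root of the first form into the second leaves the difference of the linear parts,
  whose coefficients must all vanish.
\<close>

lemma linear_form_dvd_imp_eq:
  assumes "0 < v" "c \<in> carrier_vec k" "d \<in> carrier_vec k" "linear_form k v c dvd linear_form k v d"
  shows "c = d"
proof -
  let ?l = "\<lambda>c. \<Sum>\<alpha><k. Const (c $ \<alpha>) * Var (v + \<alpha>)"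
  have "subst0 (- ?l c) (linear_form k v d) = 0"
    using assms(4) dvd_iff_subst0[of "- ?l c" "linear_form k v d"]
    by (simp add: linear_form_def subst0_uminus subst0_linear_part[OF assms(1)])
  then have eq: "?l c = ?l d"
    by (simp add: linear_form_def subst0_add subst0_Var subst0_linear_part[OF assms(1)])
  show ?thesis
  proof (rule eq_vecI)
    fix \<alpha> assume "\<alpha> < dim_vec d"
    then have "\<alpha> < k" using assms by auto
    then show "c $ \<alpha> = d $ \<alpha>"
      using lookup_linear_part[of \<alpha> k "\<lambda>\<alpha>. c $ \<alpha>" v] lookup_linear_part[of \<alpha> k "\<lambda>\<alpha>. d $ \<alpha>" v] eq
      by simp
  qed (use assms in auto)
qed

section \<open>Counting irreducible factors of a product of primes\<close>

lemma z0_multiplicity_eqI: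
  assumes "Q = Var 0 ^ e * R" "\<not> Var 0 dvd R"
  shows "z0_multiplicity Q = e"
proof -
  have nz: "(Var 0 :: cmpoly) \<noteq> 0"
    unfolding Var_def by (auto dest: arg_cong[of _ _ Poly_Mapping.keys])
  have "m \<le> e" if "Var 0 ^ m dvd Q" for m
  proof (rule ccontr)
    assume "\<not> m \<le> e"
    then have "Var 0 ^ Suc e dvd Var 0 ^ e * R"
      using that assms(1) le_imp_power_dvd[of "Suc e" m "Var 0 :: cmpoly"] by (meson dvd_trans not_less_eq_eq)
    then have "Var 0 ^ e * Var 0 dvd Var 0 ^ e * R" by (simp add: mult.commute)
    with nz assms(2) show False by (subst (asm) dvd_mult_cancel_left) auto
  qed
  then have "{m. Var 0 ^ m dvd Q} = {..e}"
    using assms(1) by (auto intro: dvd_trans[OF le_imp_power_dvd])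
  then show ?thesis by (auto simp: z0_multiplicity_def intro: Max_eqI)
qed

text \<open>
  If a prime \<open>u * v\<close> divides \<open>u\<close>, then cancelling leaves \<open>v\<close> as a unit.
\<close>

lemma prime_elem_imp_irreducible_idom:
  fixes P :: "'a::idom"
  assumes "prime_elem P"
  shows "irreducible P"
proof (rule irreducibleI)
  show "P \<noteq> 0" "\<not> P dvd 1" using assms by (auto simp: prime_elem_def)
  fix a b assume P: "P = a * b"
  have aux: "v dvd 1" if "P dvd u" "P = u * v" for u v
  proof -
    from that obtain w where w: "u = P * w" by (auto simp: dvd_def)
    have "P * (w * v) = u * v" unfolding w by (rule mult.assoc[symmetric])
    also have "\<dots> = P * 1" using that(2) by simp
    finally have "w * v = 1" using \<open>P \<noteq> 0\<close> by (metis mult_left_cancel)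
    then show ?thesis by (metis dvd_triv_right)
  qed
  from P have "P dvd a * b" by simp
  with assms have "P dvd a \<or> P dvd b" by (rule prime_elem_dvd_multD)
  then show "a dvd 1 \<or> b dvd 1" using aux[OF _ P] aux[of b a, OF _ P[unfolded mult.commute[of a b]]] by blast
qed

text \<open>
  Write \<open>L * R = P * S\<close>. The prime \<open>L\<close> divides \<open>P\<close>, and then the cofactor is a unit, or it divides
  \<open>S\<close>, and then it cancels.
\<close>

lemma irreducible_dvd_prime_mult:
  fixes P :: "'a::idom"
  assumes "irreducible P" "prime_elem L" "P dvd L * R"
  shows "(P dvd L \<and> L dvd P) \<or> P dvd R"
proof -
  from assms(3) obtain S where S: "L * R = P * S" ..
  have L: "L \<noteq> 0" "\<not> L dvd 1" using assms(2) by (auto simp: prime_elem_def)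
  have "L dvd P * S" unfolding S[symmetric] by (rule dvd_triv_left)
  then have "L dvd P \<or> L dvd S" by (rule prime_elem_dvd_multD[OF assms(2)])
  then show ?thesis
  proof
    assume "L dvd P"
    then obtain T where T: "P = L * T" ..
    with irreducibleD[OF assms(1) T] L(2) have "T dvd 1" by blast
    then obtain U where U: "1 = T * U" ..
    have "L = L * (T * U)" unfolding U[symmetric] by simp
    also have "\<dots> = P * U" unfolding T by (rule mult.assoc[symmetric])
    finally have "P dvd L" by (rule dvdI)
    with \<open>L dvd P\<close> show ?thesis by blast
  next
    assume "L dvd S"
    then obtain T where "S = L * T" ..
    with S have "L * R = L * (P * T)" by (simp add: mult_ac)
    with L(1) have "R = P * T" by (metis mult_left_cancel)
    then have "P dvd R" by (rule dvdI)
    then show ?thesis ..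
  qed
qed

lemma irreducible_dvd_prime_power_mult:
  fixes P :: "'a::idom"
  assumes "irreducible P" "prime_elem L" "P dvd L ^ e * R"
  shows "(P dvd L \<and> L dvd P) \<or> P dvd R"
  using assms(3)
proof (induction e)
  case (Suc e)
  then have "P dvd L * (L ^ e * R)" by (simp add: mult.assoc)
  with irreducible_dvd_prime_mult[OF assms(1,2)] Suc.IH show ?case by blast
qed simp

lemma irreducible_dvd_prime_power_prod:
  fixes P :: "'a::idom"
  assumes "finite I" "irreducible P" "P dvd (\<Prod>i\<in>I. F i ^ e i)" "\<And>i. i \<in> I \<Longrightarrow> prime_elem (F i)"
  shows "\<exists>i\<in>I. P dvd F i \<and> F i dvd P"
  using assms(1,3,4)
proof (induction I)
  case empty
  with assms(2) show ?case by (simp add: irreducible_def)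
next
  case (insert i I)
  then have "P dvd F i ^ e i * (\<Prod>i\<in>I. F i ^ e i)" by simp
  with irreducible_dvd_prime_power_mult[OF assms(2)] insert show ?case by blast
qed

text \<open>
  A set of representatives: each class of irreducible divisors meets \<open>F\<close> in exactly one element.
\<close>

lemma num_irreducible_factors_eq_card:
  assumes irred: "\<And>L. L \<in> F \<Longrightarrow> irreducible L"
    and dvd: "\<And>L. L \<in> F \<Longrightarrow> L dvd Q"
    and complete: "\<And>P. irreducible P \<Longrightarrow> P dvd Q \<Longrightarrow> \<exists>L\<in>F. P dvd L \<and> L dvd P"
    and distinct: "\<And>L L'. L \<in> F \<Longrightarrow> L' \<in> F \<Longrightarrow> L dvd L' \<Longrightarrow> L = L'"
  shows "num_irreducible_factors Q = card F"
proof -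
  let ?cl = "\<lambda>P::cmpoly. {P'. P dvd P' \<and> P' dvd P}"
  have "?cl P = ?cl L" if "P dvd L" "L dvd P" for P L
    using that by (auto intro: dvd_trans)
  then have "?cl ` {P. irreducible P \<and> P dvd Q} = ?cl ` F"
    using irred dvd complete by (auto simp: image_iff) (metis (no_types, lifting))+
  moreover have "inj_on ?cl F"
  proof (rule inj_onI)
    fix L L' assume LL': "L \<in> F" "L' \<in> F" "?cl L = ?cl L'"
    then have "L' \<in> ?cl L" by simp
    with LL' distinct show "L = L'" by blast
  qed
  ultimately show ?thesis by (simp add: num_irreducible_factors_def card_image)
qed

section \<open>Determinants of block diagonal pencils\<close>

definition pencil :: "nat \<Rightarrow> nat \<Rightarrow> nat \<Rightarrow> (nat \<Rightarrow> complex mat) \<Rightarrow> cmpoly mat" where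
  "pencil k v d F = mat d d (\<lambda>(i, j).
     (if i = j then Var 0 else 0) + (\<Sum>\<alpha><k. Var (v + \<alpha>) * Const (F \<alpha> $$ (i, j))))"

lemma pencil_carrier [simp]: "pencil k v d F \<in> carrier_mat d d"
  by (simp add: pencil_def)

lemma diag_block_mat_carrier:
  assumes "\<And>j. j \<in> set js \<Longrightarrow> B j \<in> carrier_mat (s j) (s j)"
  shows "diag_block_mat (map B js) \<in> carrier_mat (sum_list (map s js)) (sum_list (map s js))"
  using assms by (induction js) (auto simp: Let_def)

lemma diag_block_mat_Cons:
  assumes "\<And>j. j \<in> set (i # js) \<Longrightarrow> B j \<in> carrier_mat (s j) (s j)"
  defines "R \<equiv> sum_list (map s js)"
  shows "diag_block_mat (map B (i # js)) =
           four_block_mat (B i) (0\<^sub>m (s i) R) (0\<^sub>m R (s i)) (diag_block_mat (map B js))"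
proof -
  have "diag_block_mat (map B js) \<in> carrier_mat R R" "B i \<in> carrier_mat (s i) (s i)"
    using assms(1) diag_block_mat_carrier[of js B s] by (auto simp: R_def)
  then show ?thesis by (simp add: Let_def)
qed

lemma pencil_four_block:
  assumes "\<And>\<alpha>. \<alpha> < k \<Longrightarrow> F \<alpha> \<in> carrier_mat d d" "\<And>\<alpha>. \<alpha> < k \<Longrightarrow> G \<alpha> \<in> carrier_mat e e"
  shows "pencil k v (d + e) (\<lambda>\<alpha>. four_block_mat (F \<alpha>) (0\<^sub>m d e) (0\<^sub>m e d) (G \<alpha>)) =
     four_block_mat (pencil k v d F) (0\<^sub>m d e) (0\<^sub>m e d) (pencil k v e G)"
proof -
  have "four_block_mat (F \<alpha>) (0\<^sub>m d e) (0\<^sub>m e d) (G \<alpha>) $$ (i, j) =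
      (if i < d then if j < d then F \<alpha> $$ (i, j) else 0
       else if j < d then 0 else G \<alpha> $$ (i - d, j - d))"
    if "\<alpha> < k" "i < d + e" "j < d + e" for \<alpha> i j
    using assms[OF that(1)] that by auto
  then show ?thesis by (intro eq_matI) (auto simp: pencil_def)
qed

lemma pencil_cong:
  assumes "\<And>\<alpha>. \<alpha> < k \<Longrightarrow> F \<alpha> = G \<alpha>"
  shows "pencil k v d F = pencil k v d G"
  unfolding pencil_def using assms by (intro cong_mat) (auto intro: sum.cong)

lemma det_pencil_diag_block:
  assumes "\<And>j \<alpha>. j \<in> set js \<Longrightarrow> \<alpha> < k \<Longrightarrow> B \<alpha> j \<in> carrier_mat (s j) (s j)"
  shows "det (pencil k v (sum_list (map s js)) (\<lambda>\<alpha>. diag_block_mat (map (B \<alpha>) js))) =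
     (\<Prod>j\<leftarrow>js. det (pencil k v (s j) (\<lambda>\<alpha>. B \<alpha> j)))"
  using assms
proof (induction js)
  case Nil
  then show ?case by (simp add: pencil_def det_dim_zero)
next
  case (Cons i js)
  let ?R = "sum_list (map s js)"
  let ?D = "\<lambda>\<alpha>. diag_block_mat (map (B \<alpha>) js)"
  have "pencil k v (sum_list (map s (i # js))) (\<lambda>\<alpha>. diag_block_mat (map (B \<alpha>) (i # js))) =
      pencil k v (s i + ?R) (\<lambda>\<alpha>. four_block_mat (B \<alpha> i) (0\<^sub>m (s i) ?R) (0\<^sub>m ?R (s i)) (?D \<alpha>))"
    unfolding list.map sum_list.Cons
    by (rule pencil_cong) (rule diag_block_mat_Cons[unfolded list.map], use Cons.prems in auto)
  also have "\<dots> = four_block_mat (pencil k v (s i) (\<lambda>\<alpha>. B \<alpha> i)) (0\<^sub>m (s i) ?R) (0\<^sub>m ?R (s i)) (pencil k v ?R ?D)"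
    by (rule pencil_four_block) (use Cons.prems in \<open>auto intro: diag_block_mat_carrier\<close>)
  finally have "det (pencil k v (sum_list (map s (i # js))) (\<lambda>\<alpha>. diag_block_mat (map (B \<alpha>) (i # js)))) =
      det (pencil k v (s i) (\<lambda>\<alpha>. B \<alpha> i)) * det (pencil k v ?R ?D)"
    by (simp only:) (rule det_four_block_mat_lower_left_zero, auto)
  also have "det (pencil k v ?R ?D) = (\<Prod>j\<leftarrow>js. det (pencil k v (s j) (\<lambda>\<alpha>. B \<alpha> j)))"
    using Cons.prems by (intro Cons.IH) auto
  finally show ?case by simp
qed

lemma mult_block_diag:
  fixes X Y :: "'a::semiring_1 mat"
  assumes "X \<in> carrier_mat d d" "X' \<in> carrier_mat d d" "Y \<in> carrier_mat e e" "Y' \<in> carrier_mat e e"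
  shows "four_block_mat X (0\<^sub>m d e) (0\<^sub>m e d) Y * four_block_mat X' (0\<^sub>m d e) (0\<^sub>m e d) Y' =
         four_block_mat (X * X') (0\<^sub>m d e) (0\<^sub>m e d) (Y * Y')"
  using assms by (subst mult_four_block_mat[OF assms(1) zero_carrier_mat zero_carrier_mat assms(3)
      assms(2) zero_carrier_mat zero_carrier_mat assms(4)]) simp

lemma diag_block_mat_commute:
  fixes B C :: "nat \<Rightarrow> complex mat"
  assumes "\<And>j. j \<in> set js \<Longrightarrow> B j \<in> carrier_mat (s j) (s j)"
    and "\<And>j. j \<in> set js \<Longrightarrow> C j \<in> carrier_mat (s j) (s j)"
    and "\<And>j. j \<in> set js \<Longrightarrow> B j * C j = C j * B j"
  shows "diag_block_mat (map B js) * diag_block_mat (map C js) =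
         diag_block_mat (map C js) * diag_block_mat (map B js)"
  using assms
proof (induction js)
  case (Cons i js)
  let ?R = "sum_list (map s js)"
  have *: "diag_block_mat (map B js) \<in> carrier_mat ?R ?R" "diag_block_mat (map C js) \<in> carrier_mat ?R ?R"
    using Cons.prems by (auto intro: diag_block_mat_carrier)
  have **: "B i \<in> carrier_mat (s i) (s i)" "C i \<in> carrier_mat (s i) (s i)" "B i * C i = C i * B i"
    using Cons.prems by auto
  have IH: "diag_block_mat (map B js) * diag_block_mat (map C js) =
         diag_block_mat (map C js) * diag_block_mat (map B js)"
    using Cons by auto
  have D: "diag_block_mat (map B (i # js)) =
           four_block_mat (B i) (0\<^sub>m (s i) ?R) (0\<^sub>m ?R (s i)) (diag_block_mat (map B js))"
       "diag_block_mat (map C (i # js)) =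
           four_block_mat (C i) (0\<^sub>m (s i) ?R) (0\<^sub>m ?R (s i)) (diag_block_mat (map C js))"
    using Cons.prems by (auto intro!: diag_block_mat_Cons simp del: list.map diag_block_mat.simps)
  show ?case
    unfolding D using * ** IH by (simp add: mult_block_diag)
qed simp

text \<open>
  The position of block \<open>j\<close> in the large matrix depends only on the block sizes, so one index \<open>i\<close>
  serves the whole family. This is what allows comparing coefficients in a linear relation.
\<close>

lemma diag_block_mat_contains_corner:
  assumes "\<And>j \<alpha>. j \<in> set js \<Longrightarrow> \<alpha> < k \<Longrightarrow> B \<alpha> j \<in> carrier_mat (s j) (s j)"
    and "j \<in> set js" "0 < s j"
  shows "\<exists>i<sum_list (map s js). \<forall>\<alpha><k. diag_block_mat (map (B \<alpha>) js) $$ (i, i) = B \<alpha> j $$ (0, 0)"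
  using assms
proof (induction js)
  case (Cons l js)
  let ?R = "sum_list (map s js)"
  have D: "diag_block_mat (map (B \<alpha>) (l # js)) =
           four_block_mat (B \<alpha> l) (0\<^sub>m (s l) ?R) (0\<^sub>m ?R (s l)) (diag_block_mat (map (B \<alpha>) js))"
     and E: "diag_block_mat (map (B \<alpha>) js) \<in> carrier_mat ?R ?R"
     and F: "B \<alpha> l \<in> carrier_mat (s l) (s l)"
    if "\<alpha> < k" for \<alpha>
    using Cons.prems(1) that
    by (auto intro!: diag_block_mat_Cons diag_block_mat_carrier simp del: list.map diag_block_mat.simps)
  have entry: "diag_block_mat (map (B \<alpha>) (l # js)) $$ (i, i) =
      (if i < s l then B \<alpha> l $$ (i, i) else diag_block_mat (map (B \<alpha>) js) $$ (i - s l, i - s l))"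
    if "\<alpha> < k" "i < s l + ?R" for \<alpha> i
    unfolding D[OF that(1)] using E[OF that(1)] F[OF that(1)] that(2) by auto
  have "\<exists>i<s l + ?R. \<forall>\<alpha><k. diag_block_mat (map (B \<alpha>) (l # js)) $$ (i, i) = B \<alpha> j $$ (0, 0)"
  proof (cases "j = l")
    case True
    with Cons.prems(3) show ?thesis
      by (intro exI[of _ 0]) (simp add: entry del: list.map diag_block_mat.simps)
  next
    case False
    then obtain i where "i < ?R" "\<forall>\<alpha><k. diag_block_mat (map (B \<alpha>) js) $$ (i, i) = B \<alpha> j $$ (0, 0)"
      using Cons by auto
    then show ?thesis
      by (intro exI[of _ "s l + i"]) (simp add: entry del: list.map diag_block_mat.simps)
  qed
  then show ?case by simp
qed simp

text \<open>
  Each member of the span is triangular on one side, but that side could a priori depend on the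
  member. If \<open>M \<alpha>\<close> were not upper and \<open>M \<beta>\<close> not lower triangular, then \<open>M \<alpha> + M \<beta>\<close> would be neither:
  a linear space is not the union of two proper subspaces.
\<close>

lemma abelian_strictly_triangular_uniform:
  assumes "spans_abelian_strictly_triangular d k M"
  shows "(\<forall>\<alpha><k. \<forall>i<d. \<forall>j<d. j \<le> i \<longrightarrow> M \<alpha> $$ (i, j) = 0) \<or>
         (\<forall>\<alpha><k. \<forall>i<d. \<forall>j<d. i \<le> j \<longrightarrow> M \<alpha> $$ (i, j) = 0)"
proof -
  \<comment> \<open>Strict upper and strict lower triangularity of the combination with coefficients \<open>c\<close>.\<close>
  define U where "U c \<longleftrightarrow> (\<forall>i<d. \<forall>j<d. j \<le> i \<longrightarrow> (\<Sum>\<alpha><k. c \<alpha> * M \<alpha> $$ (i, j)) = 0)" for c :: "nat \<Rightarrow> complex"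
  define V where "V c \<longleftrightarrow> (\<forall>i<d. \<forall>j<d. i \<le> j \<longrightarrow> (\<Sum>\<alpha><k. c \<alpha> * M \<alpha> $$ (i, j)) = 0)" for c :: "nat \<Rightarrow> complex"
  have UV: "U c \<or> V c" for c
  proof -
    let ?X = "mat d d (\<lambda>(i, j). \<Sum>\<alpha><k. c \<alpha> * M \<alpha> $$ (i, j))"
    have "?X \<in> mat_span d k M" unfolding mat_span_def by blast
    with assms have "strictly_triangular ?X"
      unfolding spans_abelian_strictly_triangular_def by blast
    then show ?thesis unfolding strictly_triangular_def U_def V_def by auto
  qed
  let ?e = "\<lambda>\<alpha> \<beta>. if \<beta> = \<alpha> then 1 else (0::complex)"
  have e: "(\<Sum>\<beta><k. ?e \<alpha> \<beta> * f \<beta>) = f \<alpha>" if "\<alpha> < k" for \<alpha> and f :: "nat \<Rightarrow> complex"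
    using that by (simp add: if_distrib[of "\<lambda>c. c * _"] cong: if_cong)
  have "(\<forall>\<alpha><k. U (?e \<alpha>)) \<or> (\<forall>\<alpha><k. V (?e \<alpha>))"
  proof (rule ccontr)
    assume "\<not> ?thesis"
    then obtain \<alpha> \<beta> where ab: "\<alpha> < k" "\<beta> < k" "\<not> U (?e \<alpha>)" "\<not> V (?e \<beta>)" by blast
    then have "V (?e \<alpha>)" "U (?e \<beta>)" using UV by blast+
    have "U (\<lambda>\<gamma>. ?e \<alpha> \<gamma> + ?e \<beta> \<gamma>) \<or> V (\<lambda>\<gamma>. ?e \<alpha> \<gamma> + ?e \<beta> \<gamma>)" by (rule UV)
    then show False
    proof
      assume "U (\<lambda>\<gamma>. ?e \<alpha> \<gamma> + ?e \<beta> \<gamma>)"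
      with \<open>U (?e \<beta>)\<close> have "U (?e \<alpha>)"
        unfolding U_def distrib_right sum.distrib by auto
      with ab show False by simp
    next
      assume "V (\<lambda>\<gamma>. ?e \<alpha> \<gamma> + ?e \<beta> \<gamma>)"
      with \<open>V (?e \<alpha>)\<close> have "V (?e \<beta>)"
        unfolding V_def distrib_right sum.distrib by auto
      with ab show False by simp
    qed
  qed
  then show ?thesis unfolding U_def V_def by (simp add: e)
qed

text \<open>
  One-sided triangularity of all \<open>M \<alpha>\<close> at once makes the pencil triangular, and strictness leaves the
  same linear form in every diagonal entry.
\<close>

lemma det_pencil_block:
  assumes "spans_abelian_strictly_triangular d k M"
  shows "det (pencil k v d (\<lambda>\<alpha>. c $ \<alpha> \<cdot>\<^sub>m 1\<^sub>m d + M \<alpha>)) = linear_form k v c ^ d"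
proof -
  let ?P = "pencil k v d (\<lambda>\<alpha>. c $ \<alpha> \<cdot>\<^sub>m 1\<^sub>m d + M \<alpha>)"
  have M: "M \<alpha> \<in> carrier_mat d d" if "\<alpha> < k" for \<alpha>
    using assms that by (simp add: spans_abelian_strictly_triangular_def)
  have entry: "?P $$ (i, j) = (if i = j then Var 0 else 0) +
      (\<Sum>\<alpha><k. Var (v + \<alpha>) * Const ((if i = j then c $ \<alpha> else 0) + M \<alpha> $$ (i, j)))"
    if "i < d" "j < d" for i j
  proof -
    have "(c $ \<alpha> \<cdot>\<^sub>m 1\<^sub>m d + M \<alpha>) $$ (i, j) = (if i = j then c $ \<alpha> else 0) + M \<alpha> $$ (i, j)"
      if "\<alpha> < k" for \<alpha>
      using M[OF that] \<open>i < d\<close> \<open>j < d\<close> by auto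
    with that show ?thesis by (simp add: pencil_def)
  qed
  have diag: "M \<alpha> $$ (i, i) = 0" if "\<alpha> < k" "i < d" for \<alpha> i
    using abelian_strictly_triangular_uniform[OF assms] that by auto
  have "diag_mat ?P = replicate d (linear_form k v c)"
    by (rule nth_equalityI)
       (auto simp: diag_mat_def carrier_matD[OF pencil_carrier] entry diag linear_form_def mult.commute)
  moreover have "det ?P = prod_list (diag_mat ?P)"
    using abelian_strictly_triangular_uniform[OF assms]
  proof
    assume "\<forall>\<alpha><k. \<forall>i<d. \<forall>j<d. j \<le> i \<longrightarrow> M \<alpha> $$ (i, j) = 0"
    then have "upper_triangular ?P"
      by (auto simp: upper_triangular_def carrier_matD[OF pencil_carrier] entry)
    then show ?thesis by (rule det_upper_triangular[OF _ pencil_carrier])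
  next
    assume "\<forall>\<alpha><k. \<forall>i<d. \<forall>j<d. i \<le> j \<longrightarrow> M \<alpha> $$ (i, j) = 0"
    then have "?P $$ (i, j) = 0" if "i < j" "j < d" for i j
      using that by (simp add: entry)
    then show ?thesis by (rule det_lower_triangular[OF _ pencil_carrier])
  qed
  ultimately show ?thesis by simp
qed

section \<open>The adjoint action on an abelian ideal\<close>

lemma sum_lessThan_add:
  fixes f :: "nat \<Rightarrow> 'b::comm_monoid_add"
  shows "sum f {..<r + k} = sum f {..<r} + (\<Sum>\<alpha><k. f (r + \<alpha>))"
  by (induction k) (simp_all add: add.assoc)

context complex_lie_algebra
begin

lemma bracket_zero_right [simp]: "bracket u 0 = 0"
  using bracket_add_right[of u 0 0] by simp

lemma bracket_zero_left [simp]: "bracket 0 u = 0"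
  using bracket_add_left[of 0 0 u] by simp

lemma bracket_sum_right: "bracket u (sum f S) = (\<Sum>i\<in>S. bracket u (f i))"
  by (induction S rule: infinite_finite_induct) (simp_all add: bracket_add_right)

lemma bracket_sum_left: "bracket (sum f S) u = (\<Sum>i\<in>S. bracket (f i) u)"
  by (induction S rule: infinite_finite_induct) (simp_all add: bracket_add_left)

lemma bracket_anticommute: "bracket v u = - bracket u v"
proof -
  have "bracket (u + v) (u + v) = bracket u v + bracket v u"
    unfolding bracket_add_left bracket_add_right by (simp add: bracket_self)
  then have "bracket u v + bracket v u = 0" by (simp add: bracket_self)
  then show ?thesis by (simp add: eq_neg_iff_add_eq_0 add.commute)
qed

text \<open>
  Vanishing of coefficients over the index set also yields injectivity, since a repeated vector gives
  a relation with coefficients \<open>1\<close> and \<open>-1\<close>.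
\<close>

lemma ordered_basisI:
  assumes indep: "\<And>c i. (\<Sum>i<d. c i *s b i) = 0 \<Longrightarrow> i < d \<Longrightarrow> c i = 0"
    and "span (b ` {..<d}) = V"
  shows "is_ordered_basis d b V"
proof -
  have inj: "inj_on b {..<d}"
  proof (rule inj_onI, rule ccontr)
    fix i j assume ij: "i \<in> {..<d}" "j \<in> {..<d}" "b i = b j" "i \<noteq> j"
    let ?c = "\<lambda>l. if l = i then 1 else if l = j then - 1 else (0::complex)"
    have "(\<Sum>l<d. ?c l *s b l) = (\<Sum>l\<in>{i, j}. ?c l *s b l)"
      using ij by (intro sum.mono_neutral_right) auto
    also have "\<dots> = 0" using ij by simp
    finally have "?c i = 0" using ij by (intro indep) auto
    then show False by simp
  qed
  moreover have "independent (b ` {..<d})"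
  proof (rule independent_if_scalars_zero)
    fix f v assume "(\<Sum>x\<in>b ` {..<d}. f x *s x) = 0" "v \<in> b ` {..<d}"
    then show "f v = 0" using indep[of "\<lambda>i. f (b i)"] by (auto simp: sum.reindex[OF inj])
  qed simp
  ultimately show ?thesis using assms(2) by (simp add: is_ordered_basis_def)
qed

lemma ordered_basis_independent:
  assumes "is_ordered_basis d b V" "(\<Sum>i<d. c i *s b i) = 0" "i < d"
  shows "c i = 0"
proof -
  have inj: "inj_on b {..<d}" and indep: "independent (b ` {..<d})"
    using assms(1) by (auto simp: is_ordered_basis_def)
  let ?f = "\<lambda>v. c (the_inv_into {..<d} b v)"
  have "(\<Sum>v\<in>b ` {..<d}. ?f v *s v) = (\<Sum>i<d. c i *s b i)"
    by (simp add: sum.reindex[OF inj] the_inv_into_f_f[OF inj])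
  then have "?f (b i) = 0"
    using assms by (intro independentD[OF indep, of "b ` {..<d}" ?f]) auto
  then show ?thesis using assms(3) by (simp add: the_inv_into_f_f[OF inj])
qed

lemma ordered_basis_coords:
  assumes "is_ordered_basis d b V" "v \<in> V"
  obtains c where "v = (\<Sum>i<d. c i *s b i)"
proof -
  have inj: "inj_on b {..<d}" and "span (b ` {..<d}) = V"
    using assms(1) by (auto simp: is_ordered_basis_def)
  with assms(2) obtain u where "v = (\<Sum>w\<in>b ` {..<d}. u w *s w)"
    by (auto simp: span_finite)
  then have "v = (\<Sum>i<d. u (b i) *s b i)" by (simp add: sum.reindex[OF inj])
  then show ?thesis by (rule that)
qed

lemma ordered_basis_combination_mem:
  assumes "is_ordered_basis d b V"
  shows "(\<Sum>i<d. c i *s b i) \<in> V"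
proof -
  have "V = span (b ` {..<d})" using assms by (simp add: is_ordered_basis_def)
  then show ?thesis by (simp only:) (intro span_sum span_scale span_base, auto)
qed

lemma representation_ordered_basis:
  assumes "is_ordered_basis d b V" "i < d"
  shows "representation (b ` {..<d}) (\<Sum>l<d. c l *s b l) (b i) = c i"
proof -
  have inj: "inj_on b {..<d}" and indep: "independent (b ` {..<d})"
    using assms(1) by (auto simp: is_ordered_basis_def)
  have mem: "c l *s b l \<in> span (b ` {..<d})" if "l \<in> {..<d}" for l
    using that by (auto intro: span_scale span_base)
  have "representation (b ` {..<d}) (c l *s b l) (b i) = c l * (if b i = b l then 1 else 0)" if "l < d" for l
    using that by (simp add: representation_scale[OF indep] representation_basis[OF indep] span_base)
  then have "representation (b ` {..<d}) (\<Sum>l<d. c l *s b l) (b i) = (\<Sum>l<d. c l * (if b i = b l then 1 else 0))"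
    using representation_sum[OF indep, of "{..<d}" "\<lambda>l. c l *s b l", OF mem] by simp
  also have "\<dots> = (\<Sum>l<d. if l = i then c l else 0)"
    using inj assms(2) by (intro sum.cong refl) (auto simp: inj_on_eq_iff)
  finally show ?thesis using assms(2) by simp
qed

lemma ordered_basis_append:
  assumes n: "is_ordered_basis r n V" and x: "is_ordered_basis k x W" and "is_complement V W"
  shows "is_ordered_basis (r + k) (\<lambda>i. if i < r then n i else x (i - r)) UNIV"
    (is "is_ordered_basis _ ?b _")
proof (rule ordered_basisI)
  have sub: "subspace V" "subspace W" and VW: "V \<inter> W = {0}" "{v + w | v w. v \<in> V \<and> w \<in> W} = UNIV"
    using assms(3) by (auto simp: is_complement_def)
  fix c i assume eq: "(\<Sum>i<r + k. c i *s ?b i) = 0" and i: "i < r + k"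
  let ?v = "\<Sum>i<r. c i *s n i" and ?w = "\<Sum>\<alpha><k. c (r + \<alpha>) *s x \<alpha>"
  have "?v + ?w = 0" using eq by (simp add: sum_lessThan_add)
  then have vw: "?v = - ?w" by (simp add: eq_neg_iff_add_eq_0)
  have "?v \<in> V" "?w \<in> W" using n x by (auto intro: ordered_basis_combination_mem)
  then have "?v \<in> W" unfolding vw using subspace_neg[OF sub(2)] by blast
  with \<open>?v \<in> V\<close> VW(1) have "?v = 0" by blast
  with vw have "?w = 0" by simp
  from \<open>?v = 0\<close> \<open>?w = 0\<close> show "c i = 0"
    using ordered_basis_independent[OF n, of c i] i
      ordered_basis_independent[OF x, of "\<lambda>\<alpha>. c (r + \<alpha>)" "i - r"]
    by (cases "i < r") auto
next
  have "?b ` {..<r + k} = n ` {..<r} \<union> x ` {..<k}"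
  proof (intro equalityI subsetI)
    fix v assume "v \<in> n ` {..<r} \<union> x ` {..<k}"
    then consider i where "i < r" "v = n i" | \<alpha> where "\<alpha> < k" "v = x \<alpha>" by auto
    then show "v \<in> ?b ` {..<r + k}"
    proof cases
      case 1
      then show ?thesis by (intro image_eqI[of _ _ i]) auto
    next
      case 2
      then show ?thesis by (intro image_eqI[of _ _ "r + \<alpha>"]) auto
    qed
  qed auto
  then show "span (?b ` {..<r + k}) = UNIV"
    using assms by (simp add: span_Un is_ordered_basis_def is_complement_def)
qed

text \<open>
  By the Jacobi identity the bracket acts on \<open>V\<close> as the commutator of \<open>A \<alpha>\<close> and \<open>A \<beta>\<close>, so it
  centralizes \<open>V\<close>. Its component in \<open>V\<close> acts trivially on \<open>V\<close>; hence so does its component in the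
  complement, and the independence of the matrices makes that component zero.
\<close>

lemma bracket_complement_mem_ideal:
  assumes V: "is_abelian V" "is_ordered_basis r n V"
    and W: "is_ordered_basis k x W" "is_complement V W"
    and A: "\<And>\<alpha> j. \<alpha> < k \<Longrightarrow> j < r \<Longrightarrow> bracket (x \<alpha>) (n j) = (\<Sum>i<r. A \<alpha> $$ (i, j) *s n i)"
    and carrier: "\<And>\<alpha>. \<alpha> < k \<Longrightarrow> A \<alpha> \<in> carrier_mat r r"
    and commute: "\<And>\<alpha> \<beta>. \<alpha> < k \<Longrightarrow> \<beta> < k \<Longrightarrow> A \<alpha> * A \<beta> = A \<beta> * A \<alpha>"
    and indep: "\<And>c \<alpha>. (\<And>i j. i < r \<Longrightarrow> j < r \<Longrightarrow> (\<Sum>\<alpha><k. c \<alpha> * A \<alpha> $$ (i, j)) = 0) \<Longrightarrow> \<alpha> < k \<Longrightarrow> c \<alpha> = 0"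
    and ab: "\<alpha> < k" "\<beta> < k"
  shows "bracket (x \<alpha>) (x \<beta>) \<in> V"
proof -
  let ?u = "bracket (x \<alpha>) (x \<beta>)"
  have double: "bracket (x \<alpha>) (bracket (x \<beta>) (n j)) = (\<Sum>i<r. (A \<alpha> * A \<beta>) $$ (i, j) *s n i)"
    if ab: "\<alpha> < k" "\<beta> < k" and j: "j < r" for \<alpha> \<beta> j
  proof -
    have prod: "(A \<alpha> * A \<beta>) $$ (i, j) = (\<Sum>l<r. A \<alpha> $$ (i, l) * A \<beta> $$ (l, j))" if "i < r" for i
      using carrier[OF ab(1)] carrier[OF ab(2)] that j
      by (auto simp: scalar_prod_def atLeast0LessThan)
    have "bracket (x \<alpha>) (bracket (x \<beta>) (n j)) = (\<Sum>l<r. \<Sum>i<r. (A \<alpha> $$ (i, l) * A \<beta> $$ (l, j)) *s n i)"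
      using ab j by (simp add: A bracket_sum_right bracket_scale_right scale_sum_right mult.commute)
    also have "\<dots> = (\<Sum>i<r. (A \<alpha> * A \<beta>) $$ (i, j) *s n i)"
      by (subst sum.swap) (simp add: prod scale_sum_left)
    finally show ?thesis .
  qed
  have centralizes: "bracket ?u (n j) = 0" if j: "j < r" for j
  proof -
    have "bracket (x \<alpha>) (bracket (x \<beta>) (n j)) - bracket (x \<beta>) (bracket (x \<alpha>) (n j)) = bracket ?u (n j)"
    proof -
      have neg: "bracket (x \<beta>) (- bracket (x \<alpha>) (n j)) = - bracket (x \<beta>) (bracket (x \<alpha>) (n j))"
        using bracket_add_right[of "x \<beta>" "bracket (x \<alpha>) (n j)" "- bracket (x \<alpha>) (n j)"]
        by (simp add: eq_neg_iff_add_eq_0 add.commute)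
      show ?thesis
        using jacobi[of "x \<alpha>" "x \<beta>" "n j"] bracket_anticommute[of "n j" ?u] bracket_anticommute[of "n j" "x \<alpha>"]
        by (simp add: neg)
    qed
    then show ?thesis using double[OF ab j] double[OF ab(2,1) j] commute[OF ab] by simp
  qed
  have "\<exists>v w. ?u = v + w \<and> v \<in> V \<and> w \<in> W" using W(2) unfolding is_complement_def by blast
  then obtain v w where u: "?u = v + w" "v \<in> V" "w \<in> W" by blast
  obtain c where w: "w = (\<Sum>\<gamma><k. c \<gamma> *s x \<gamma>)" using ordered_basis_coords[OF W(1) u(3)] .
  have nV: "n j \<in> V" if "j < r" for j
    using V(2) that by (auto simp: is_ordered_basis_def intro: span_base)
  have "c \<gamma> = 0" if "\<gamma> < k" for \<gamma>
  proof (rule indep[OF _ that])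
    fix i j assume ij: "i < r" "j < r"
    have "bracket ?u (n j) = bracket v (n j) + bracket w (n j)" by (simp add: u(1) bracket_add_left)
    also have "bracket v (n j) = 0" using V(1) u(2) nV[OF ij(2)] by (simp add: is_abelian_def)
    also have "bracket w (n j) = (\<Sum>\<gamma><k. \<Sum>i<r. (c \<gamma> * A \<gamma> $$ (i, j)) *s n i)"
      using ij by (simp add: w bracket_sum_left bracket_scale_left A scale_sum_right)
    also have "\<dots> = (\<Sum>i<r. (\<Sum>\<gamma><k. c \<gamma> * A \<gamma> $$ (i, j)) *s n i)"
      by (subst sum.swap) (simp add: scale_sum_left)
    finally show "(\<Sum>\<gamma><k. c \<gamma> * A \<gamma> $$ (i, j)) = 0"
      using centralizes[OF ij(2)] ordered_basis_independent[OF V(2) _ ij(1), of "\<lambda>i. \<Sum>\<gamma><k. c \<gamma> * A \<gamma> $$ (i, j)"]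
      by simp
  qed
  then have "w = 0" by (simp add: w)
  with u show ?thesis by simp
qed

text \<open>
  All brackets lie in \<open>V\<close>, so the last \<open>k\<close> rows of every adjoint matrix are zero, and vectors of \<open>V\<close>
  kill \<open>V\<close>, so only the matrices \<open>A \<alpha>\<close> survive in the upper left corner.
\<close>

lemma lie_char_poly_abelian_ideal:
  assumes V: "is_ideal V" "is_abelian V" "is_ordered_basis r n V"
    and W: "is_ordered_basis k x W" "is_complement V W"
    and A: "\<And>\<alpha> j. \<alpha> < k \<Longrightarrow> j < r \<Longrightarrow> bracket (x \<alpha>) (n j) = (\<Sum>i<r. A \<alpha> $$ (i, j) *s n i)"
    and derived: "\<And>\<alpha> \<beta>. \<alpha> < k \<Longrightarrow> \<beta> < k \<Longrightarrow> bracket (x \<alpha>) (x \<beta>) \<in> V"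
  defines "b \<equiv> \<lambda>i. if i < r then n i else x (i - r)"
  shows "lie_char_poly (r + k) b = Var 0 ^ k * det (pencil k (r + 1) r A)"
proof -
  let ?d = "r + k"
  have basis: "is_ordered_basis ?d b UNIV"
    unfolding b_def by (rule ordered_basis_append[OF V(3) W])
  have nV: "n j \<in> V" if "j < r" for j
    using V(3) that by (auto simp: is_ordered_basis_def intro: span_base)
  have sub: "subspace V" using V(1) by (simp add: is_ideal_def)
  have into: "bracket (b l) (b j) \<in> V" if "l < ?d" "j < ?d" for l j
  proof (cases "j < r")
    case True
    then show ?thesis using V(1) nV by (auto simp: is_ideal_def b_def)
  next
    case j: False
    show ?thesis
    proof (cases "l < r")
      case True
      then have "bracket (b j) (b l) \<in> V" using V(1) nV by (auto simp: is_ideal_def b_def)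
      then show ?thesis by (subst bracket_anticommute) (rule subspace_neg[OF sub])
    next
      case False
      with j that show ?thesis by (auto simp: b_def intro: derived)
    qed
  qed
  have coords: "ad_mat ?d b (b l) $$ (i, j) = (if i < r then c i else 0)"
    if "bracket (b l) (b j) = (\<Sum>i<r. c i *s n i)" "i < ?d" "j < ?d" for i j l c
  proof -
    have "(\<Sum>i<?d. (if i < r then c i else 0) *s b i) = (\<Sum>i<r. c i *s n i)"
      by (simp add: sum_lessThan_add b_def)
    then show ?thesis
      using that representation_ordered_basis[OF basis that(2), of "\<lambda>i. if i < r then c i else 0"]
      by (simp add: ad_mat_def)
  qed
  have low: "ad_mat ?d b (b l) $$ (i, j) = 0" if "l < ?d" "r \<le> i" "i < ?d" "j < ?d" for l i j
  proof -
    from into[OF that(1,4)] obtain c where "bracket (b l) (b j) = (\<Sum>i<r. c i *s n i)"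
      by (rule ordered_basis_coords[OF V(3)])
    from coords[OF this that(3,4)] that(2) show ?thesis by simp
  qed
  have corner_n: "ad_mat ?d b (b l) $$ (i, j) = 0" if "l < r" "i < r" "j < r" for l i j
  proof -
    have "bracket (b l) (b j) = (\<Sum>i<r. 0 *s n i)"
      using V(2) nV that by (simp add: is_abelian_def b_def)
    from coords[OF this, of i] that show ?thesis by simp
  qed
  have corner_x: "ad_mat ?d b (b (r + \<alpha>)) $$ (i, j) = A \<alpha> $$ (i, j)" if "\<alpha> < k" "i < r" "j < r" for \<alpha> i j
  proof -
    have "bracket (b (r + \<alpha>)) (b j) = (\<Sum>i<r. A \<alpha> $$ (i, j) *s n i)"
      using that by (simp add: A b_def)
    from coords[OF this, of i] that show ?thesis by simp
  qed
  let ?entry = "\<lambda>(i, j). (if i = j then Var 0 else 0) +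
      (\<Sum>l<?d. Var (Suc l) * Const (ad_mat ?d b (b l) $$ (i, j)))"
  let ?U = "mat r k (\<lambda>(i, j). ?entry (i, r + j))"
  have "mat ?d ?d ?entry =
      four_block_mat (pencil k (r + 1) r A) ?U (0\<^sub>m k r) (Var 0 \<cdot>\<^sub>m 1\<^sub>m k)" (is "?M = ?F")
  proof (rule eq_matI)
    fix i j assume "i < dim_row ?F" "j < dim_col ?F"
    then have ij: "i < ?d" "j < ?d" by (auto simp: carrier_matD[OF pencil_carrier])
    then consider "i < r" "j < r" | "i < r" "r \<le> j" | "r \<le> i" by linarith
    then show "?M $$ (i, j) = ?F $$ (i, j)"
    proof cases
      case 1
      then show ?thesis using ij
        by (simp add: carrier_matD[OF pencil_carrier] pencil_def sum_lessThan_add corner_n corner_x)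
    next
      case 2
      then show ?thesis using ij by (simp add: carrier_matD[OF pencil_carrier])
    next
      case 3
      then show ?thesis using ij low[of _ i j] by (auto simp: carrier_matD[OF pencil_carrier])
    qed
  qed (auto simp: carrier_matD[OF pencil_carrier])
  then have "lie_char_poly ?d b = det ?F" by (simp add: lie_char_poly_def)
  also have "\<dots> = det (pencil k (r + 1) r A) * det (Var 0 \<cdot>\<^sub>m 1\<^sub>m k :: cmpoly mat)"
    by (rule det_four_block_mat_lower_left_zero) auto
  finally show ?thesis by (simp add: mult.commute)
qed

end

section \<open>Matrices in block form\<close>

lemma linear_form_zero [simp]: "linear_form k v (0\<^sub>v k) = Var 0"
  by (simp add: linear_form_def)

lemma block_formD:
  assumes "block_form r k p q s a N A"
  shows block_form_size: "sum_list (map s [0..<p + q]) = r"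
    and block_form_diag_block: "\<And>\<alpha>. \<alpha> < k \<Longrightarrow>
      A \<alpha> = diag_block_mat (map (\<lambda>j. a j $ \<alpha> \<cdot>\<^sub>m 1\<^sub>m (s j) + N j \<alpha>) [0..<p + q])"
    and block_form_triangular: "\<And>j. j < p + q \<Longrightarrow> spans_abelian_strictly_triangular (s j) k (N j)"
    and block_form_block_carrier: "\<And>j \<alpha>. j < p + q \<Longrightarrow> \<alpha> < k \<Longrightarrow> N j \<alpha> \<in> carrier_mat (s j) (s j)"
  using assms by (auto simp: block_form_def spans_abelian_strictly_triangular_def
      interv_sum_list_conv_sum_set_nat atLeast0LessThan)

lemma block_form_carrier:
  assumes bf: "block_form r k p q s a N A" and "\<alpha> < k"
  shows "A \<alpha> \<in> carrier_mat r r"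
  unfolding block_form_diag_block[OF assms] block_form_size[OF bf, symmetric]
  using block_form_block_carrier[OF bf _ assms(2)] by (intro diag_block_mat_carrier) auto

text \<open>
  Scalar parts are central, so only the nilpotent parts of equal blocks have to commute.
\<close>

lemma block_form_commute:
  assumes bf: "block_form r k p q s a N A" and "\<alpha> < k" "\<beta> < k"
  shows "A \<alpha> * A \<beta> = A \<beta> * A \<alpha>"
proof -
  let ?B = "\<lambda>\<alpha> j. a j $ \<alpha> \<cdot>\<^sub>m 1\<^sub>m (s j) + N j \<alpha>"
  note N = block_form_triangular[OF bf]
  note carrier = block_form_block_carrier[OF bf]
  have mem: "N j \<gamma> \<in> mat_span (s j) k (N j)" if "j < p + q" "\<gamma> < k" for j \<gamma>
  proof -
    have "N j \<gamma> = mat (s j) (s j) (\<lambda>(i, l). \<Sum>\<alpha><k. (if \<alpha> = \<gamma> then 1 else 0) * N j \<alpha> $$ (i, l))"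
      using carrier[OF that] that
      by (intro eq_matI) (auto simp: if_distrib[of "\<lambda>c. c * _"] cong: if_cong)
    then show ?thesis unfolding mat_span_def
      by (intro CollectI exI[of _ "\<lambda>\<alpha>. if \<alpha> = \<gamma> then 1 else 0"] conjI) auto
  qed
  have "?B \<alpha> j * ?B \<beta> j = ?B \<beta> j * ?B \<alpha> j" if j: "j < p + q" for j
  proof -
    have NN: "N j \<alpha> * N j \<beta> = N j \<beta> * N j \<alpha>"
      using N[OF j] mem[OF j assms(2)] mem[OF j assms(3)]
      by (simp add: spans_abelian_strictly_triangular_def)
    have expand: "(c \<cdot>\<^sub>m 1\<^sub>m (s j) + X) * (d \<cdot>\<^sub>m 1\<^sub>m (s j) + Y) =
        (c * d) \<cdot>\<^sub>m 1\<^sub>m (s j) + c \<cdot>\<^sub>m Y + d \<cdot>\<^sub>m X + X * Y"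
      if XY: "X \<in> carrier_mat (s j) (s j)" "Y \<in> carrier_mat (s j) (s j)" for c d and X Y :: "complex mat"
    proof -
      have I: "c \<cdot>\<^sub>m 1\<^sub>m (s j) \<in> carrier_mat (s j) (s j)" for c :: complex by simp
      have "(c \<cdot>\<^sub>m 1\<^sub>m (s j) + X) * (d \<cdot>\<^sub>m 1\<^sub>m (s j) + Y) =
          (c \<cdot>\<^sub>m 1\<^sub>m (s j) + X) * (d \<cdot>\<^sub>m 1\<^sub>m (s j)) + (c \<cdot>\<^sub>m 1\<^sub>m (s j) + X) * Y"
        using XY by (intro mult_add_distrib_mat[where nr = "s j" and n = "s j" and nc = "s j"]) auto
      also have "(c \<cdot>\<^sub>m 1\<^sub>m (s j) + X) * (d \<cdot>\<^sub>m 1\<^sub>m (s j)) = d \<cdot>\<^sub>m (c \<cdot>\<^sub>m 1\<^sub>m (s j) + X)"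
        using XY by (subst mult_smult_distrib[of _ "s j" "s j"]) auto
      also have "(c \<cdot>\<^sub>m 1\<^sub>m (s j) + X) * Y = c \<cdot>\<^sub>m Y + X * Y"
        using XY by (subst add_mult_distrib_mat[OF I]) auto
      also have "d \<cdot>\<^sub>m (c \<cdot>\<^sub>m 1\<^sub>m (s j) + X) + (c \<cdot>\<^sub>m Y + X * Y) =
          (c * d) \<cdot>\<^sub>m 1\<^sub>m (s j) + c \<cdot>\<^sub>m Y + d \<cdot>\<^sub>m X + X * Y"
        using XY by (intro eq_matI) (auto simp: algebra_simps)
      finally show ?thesis .
    qed
    have Na: "N j \<alpha> \<in> carrier_mat (s j) (s j)" "N j \<beta> \<in> carrier_mat (s j) (s j)"
      using carrier j assms by auto
    show ?thesis
      unfolding expand[OF Na] expand[OF Na(2,1)] NN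
      using Na by (intro eq_matI) (auto simp: mult.commute)
  qed
  moreover have "?B \<gamma> j \<in> carrier_mat (s j) (s j)" if "j < p + q" "\<gamma> < k" for j \<gamma>
    using carrier[OF that] by simp
  ultimately have "diag_block_mat (map (?B \<alpha>) [0..<p + q]) * diag_block_mat (map (?B \<beta>) [0..<p + q]) =
      diag_block_mat (map (?B \<beta>) [0..<p + q]) * diag_block_mat (map (?B \<alpha>) [0..<p + q])"
    using assms(2,3) by (intro diag_block_mat_commute[where s = s]) auto
  then show ?thesis using block_form_diag_block[OF bf] assms(2,3) by simp
qed

text \<open>
  For \<open>\<beta> < k\<close> the weight of block \<open>\<beta>\<close> is a unit vector. The nilpotent parts have zero diagonal, so at a
  diagonal position inside that block the linear relation reads \<open>c \<beta> = 0\<close>.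
\<close>

lemma block_form_independent:
  assumes bf: "block_form r k p q s a N A"
    and zero: "\<And>i j. i < r \<Longrightarrow> j < r \<Longrightarrow> (\<Sum>\<alpha><k. c \<alpha> * A \<alpha> $$ (i, j)) = 0" and "\<beta> < k"
  shows "c \<beta> = 0"
proof -
  let ?B = "\<lambda>\<alpha> j. a j $ \<alpha> \<cdot>\<^sub>m 1\<^sub>m (s j) + N j \<alpha>"
  have b: "\<beta> < p + q" "0 < s \<beta>" using bf assms(3) by (auto simp: block_form_def Suc_le_eq)
  note N = block_form_triangular[OF bf]
  note carrier = block_form_block_carrier[OF bf]
  note r = block_form_size[OF bf]
  have "\<exists>i<sum_list (map s [0..<p + q]). \<forall>\<alpha><k.
      diag_block_mat (map (?B \<alpha>) [0..<p + q]) $$ (i, i) = ?B \<alpha> \<beta> $$ (0, 0)"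
    using b by (intro diag_block_mat_contains_corner) (auto simp: carrier)
  then obtain i where i: "i < r" "\<forall>\<alpha><k. A \<alpha> $$ (i, i) = ?B \<alpha> \<beta> $$ (0, 0)"
    using block_form_diag_block[OF bf] unfolding r by auto
  have "A \<alpha> $$ (i, i) = (if \<alpha> = \<beta> then 1 else 0)" if "\<alpha> < k" for \<alpha>
  proof -
    have "N \<beta> \<alpha> $$ (0, 0) = 0"
      using abelian_strictly_triangular_uniform[OF N[OF b(1)]] that b(2) by auto
    then show ?thesis
      using i(2) that b carrier[OF b(1) that] bf assms(3) by (auto simp: block_form_def)
  qed
  then have "(\<Sum>\<alpha><k. c \<alpha> * A \<alpha> $$ (i, i)) = (\<Sum>\<alpha><k. if \<alpha> = \<beta> then c \<alpha> else 0)"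
    by (intro sum.cong) auto
  also have "\<dots> = c \<beta>" using assms(3) by simp
  finally have "(\<Sum>\<alpha><k. c \<alpha> * A \<alpha> $$ (i, i)) = c \<beta>" .
  with zero[OF i(1) i(1)] show ?thesis by simp
qed

lemma det_pencil_block_form:
  assumes bf: "block_form r k p q s a N A"
  shows "det (pencil k v r A) = (\<Prod>j<p + q. linear_form k v (a j) ^ s j)"
proof -
  let ?B = "\<lambda>\<alpha> j. a j $ \<alpha> \<cdot>\<^sub>m 1\<^sub>m (s j) + N j \<alpha>"
  note N = block_form_triangular[OF bf]
  have carrier: "?B \<alpha> j \<in> carrier_mat (s j) (s j)" if "j \<in> set [0..<p + q]" "\<alpha> < k" for j \<alpha>
    using N[of j] that by (simp add: spans_abelian_strictly_triangular_def)
  note r = block_form_size[OF bf]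
  have "pencil k v r A = pencil k v r (\<lambda>\<alpha>. diag_block_mat (map (?B \<alpha>) [0..<p + q]))"
    using block_form_diag_block[OF bf] by (intro pencil_cong)
  then have "det (pencil k v r A) = (\<Prod>j\<leftarrow>[0..<p + q]. det (pencil k v (s j) (\<lambda>\<alpha>. ?B \<alpha> j)))"
    using det_pencil_diag_block[where js = "[0..<p + q]" and B = ?B and s = s and k = k and v = v, OF carrier]
    unfolding r by simp
  also have "\<dots> = (\<Prod>j\<leftarrow>[0..<p + q]. linear_form k v (a j) ^ s j)"
    using det_pencil_block[OF N] by (intro arg_cong[of _ _ prod_list] map_cong) auto
  finally show ?thesis by (simp add: prod.distinct_set_conv_list atLeast0LessThan flip: prod.distinct_set_conv_list)
qed

section \<open>The characteristic polynomial\<close>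

theorem theorem5p3:
  fixes scale :: "complex \<Rightarrow> 'a::ab_group_add \<Rightarrow> 'a"
    and bracket :: "'a \<Rightarrow> 'a \<Rightarrow> 'a"
    and \<nn> X :: "'a set"
    and n x b :: "nat \<Rightarrow> 'a"
    and r k p q :: nat
    and s :: "nat \<Rightarrow> nat"
    and a :: "nat \<Rightarrow> complex vec"
    and N :: "nat \<Rightarrow> nat \<Rightarrow> complex mat"
    and A :: "nat \<Rightarrow> complex mat"
    and Q :: cmpoly
  assumes "complex_lie_algebra scale bracket"
    and "complex_lie_algebra.finite_dim scale"
    and "complex_lie_algebra.is_solvable scale bracket UNIV"
    and "\<not> complex_lie_algebra.is_nilpotent scale bracket UNIV"
    and "complex_lie_algebra.is_nilradical scale bracket \<nn>"
    and "complex_lie_algebra.is_abelian bracket \<nn>"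
    and "complex_lie_algebra.is_ordered_basis scale r n \<nn>"
    and "complex_lie_algebra.is_complement scale \<nn> X"
    and "complex_lie_algebra.is_ordered_basis scale k x X"
    and "\<And>\<alpha> j. \<alpha> < k \<Longrightarrow> j < r \<Longrightarrow>
           bracket (x \<alpha>) (n j) = (\<Sum>i<r. scale (A \<alpha> $$ (i, j)) (n i))"
    and "block_form r k p q s a N A"
    and "b = (\<lambda>i. if i < r then n i else x (i - r))"
    and "Q = complex_lie_algebra.lie_char_poly scale bracket (r + k) b"
  shows "Q = Var 0 ^ z0_multiplicity Q *
               (\<Prod>j<p. (Var 0 + (\<Sum>\<alpha><k. Const (a j $ \<alpha>) * Var (r + 1 + \<alpha>))) ^ s j) \<and>
         z0_multiplicity Q = k + (\<Sum>j=p..<p + q. s j) \<and>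
         num_irreducible_factors Q = 1 + card (a ` {..<p} - {0\<^sub>v k})"
proof -
  interpret complex_lie_algebra scale bracket by (rule assms(1))
  note bf = assms(11)
  let ?L = "linear_form k (r + 1)"
  let ?e = "k + (\<Sum>j=p..<p + q. s j)"
  let ?R = "\<Prod>j<p. ?L (a j) ^ s j"
  have ideal: "is_ideal \<nn>"
    using assms(5) by (simp add: is_nilradical_def is_maximal_nilpotent_ideal_def)
  have derived: "bracket (x \<alpha>) (x \<beta>) \<in> \<nn>" if "\<alpha> < k" "\<beta> < k" for \<alpha> \<beta>
  proof (rule bracket_complement_mem_ideal[OF assms(6,7,9,8,10)])
    fix c \<gamma>
    assume "\<And>i j. i < r \<Longrightarrow> j < r \<Longrightarrow> (\<Sum>\<alpha><k. c \<alpha> * A \<alpha> $$ (i, j)) = 0" "\<gamma> < k"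
    then show "c \<gamma> = 0" by (rule block_form_independent[OF bf])
  qed (use that block_form_carrier[OF bf] block_form_commute[OF bf] in auto)
  have "Q = Var 0 ^ k * (\<Prod>j<p + q. ?L (a j) ^ s j)"
    unfolding assms(12,13)
    by (subst lie_char_poly_abelian_ideal[OF ideal assms(6,7,9,8,10) derived])
       (simp_all add: det_pencil_block_form[OF bf])
  also have "(\<Prod>j<p + q. ?L (a j) ^ s j) = ?R * (\<Prod>j=p..<p + q. ?L (a j) ^ s j)"
    by (simp add: atLeast0LessThan[symmetric] prod.atLeastLessThan_concat)
  also have "(\<Prod>j=p..<p + q. ?L (a j) ^ s j) = Var 0 ^ (\<Sum>j=p..<p + q. s j)"
    using bf by (simp add: block_form_def power_sum)
  finally have Q: "Q = Var 0 ^ ?e * ?R" by (simp add: power_add mult_ac)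

  have a: "a j \<in> carrier_vec k" "a j \<noteq> 0\<^sub>v k" "1 \<le> s j" if "j < p" for j
    using bf that by (auto simp: block_form_def)
  have k: "1 \<le> k" using bf by (simp add: block_form_def)
  have prime: "prime_elem (?L c)" for c by (rule prime_elem_linear_form) simp
  have prime0: "prime_elem (Var 0)" using prime[of "0\<^sub>v k"] by simp
  have irred: "irreducible (?L c)" for c by (rule prime_elem_imp_irreducible_idom[OF prime])
  have inj: "c = d" if "?L c dvd ?L d" "c \<in> carrier_vec k" "d \<in> carrier_vec k" for c d
    using linear_form_dvd_imp_eq[of "r + 1" c k d] that by simp
  have "\<not> Var 0 dvd ?R"
  proof
    assume "Var 0 dvd ?R"
    then obtain j where "j < p" "Var 0 dvd ?L (a j)"
      using irreducible_dvd_prime_power_prod[OF finite_lessThan irred[of "0\<^sub>v k"], of "\<lambda>j. ?L (a j)" s p] prime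
      by auto
    then show False using inj[of "0\<^sub>v k" "a j"] a[of j] by simp
  qed
  then have e: "z0_multiplicity Q = ?e" by (rule z0_multiplicity_eqI[OF Q])

  let ?W = "insert (0\<^sub>v k) (a ` {..<p})"
  have W: "c \<in> carrier_vec k" if "c \<in> ?W" for c using that a by auto
  have "num_irreducible_factors Q = card (?L ` ?W)"
  proof (rule num_irreducible_factors_eq_card)
    fix P assume "P \<in> ?L ` ?W"
    then consider "P = Var 0" | j where "j < p" "P = ?L (a j)" by auto
    then show "P dvd Q"
    proof cases
      case 1
      then show ?thesis unfolding Q using k by (auto intro!: dvd_mult2 dvd_power)
    next
      case 2
      then have "P dvd ?L (a j) ^ s j" using a[of j] by (auto intro!: dvd_power)
      also have "\<dots> dvd ?R" using 2 by (intro dvd_prodI) auto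
      finally show ?thesis unfolding Q by (rule dvd_mult)
    qed
  next
    fix P assume P: "irreducible P" "P dvd Q"
    with irreducible_dvd_prime_power_mult[OF P(1) prime0] Q
    have "(P dvd Var 0 \<and> Var 0 dvd P) \<or> P dvd ?R" by blast
    then show "\<exists>M\<in>?L ` ?W. P dvd M \<and> M dvd P"
      using irreducible_dvd_prime_power_prod[OF finite_lessThan P(1), of "\<lambda>j. ?L (a j)" s p] prime
      by auto
  next
    fix P assume "P \<in> ?L ` ?W"
    then show "irreducible P" using irred by blast
  next
    fix P P' assume "P \<in> ?L ` ?W" "P' \<in> ?L ` ?W" "P dvd P'"
    then obtain c d where "P = ?L c" "P' = ?L d" "c \<in> ?W" "d \<in> ?W" by blast
    with inj W \<open>P dvd P'\<close> show "P = P'" by metis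
  qed
  also have "\<dots> = card ?W"
    using inj W by (intro card_image inj_onI) (metis dvd_refl)
  also have "?W = insert (0\<^sub>v k) (a ` {..<p} - {0\<^sub>v k})" by auto
  also have "card \<dots> = 1 + card (a ` {..<p} - {0\<^sub>v k})" by (subst card_insert_disjoint) auto
  finally have "num_irreducible_factors Q = 1 + card (a ` {..<p} - {0\<^sub>v k})" .
  with Q e show ?thesis by (simp add: linear_form_def)
qed

end
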